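(* Let $n\ge 2$, $m\le n$, and let $A\in\mathbb{R}^{n\times m}$ have full rank. For every given $\alpha\in\left(\frac{-1}{n-1},1\right)$ there exist an equiangular matrix $S\in EM^{n\times m}_\alpha$ and an upper triangular matrix $R\in\mathbb{R}^{m\times m}$ such that $A=SR$.
   Context: For $\alpha\in\left(\frac{-1}{n-1},1\right)$, $EM^{n\times m}_\alpha$ denotes the set of all full-rank real $n\times m$ matrices $S=[s_1,\dots,s_m]$ whose columns are equiangular with $\alpha$, that is, $s_i^Ts_i=1$ for all $i$ and $s_i^Ts_j=\alpha$ for all $i\neq j$. *)

theory Defs
  imports Complex_Main "Jordan_Normal_Form.DL_Rank"
begin

definition full_rank :: "'a::field mat \<Rightarrow> bool" where
  "full_rank A \<longleftrightarrow> vec_space.rank (dim_row A) A = min (dim_row A) (dim_col A)"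

(* The range -1/(n-1) < \<alpha> < 1 is not built into the set; it is to be assumed wherever the set is used. *)
definition EM :: "nat \<Rightarrow> nat \<Rightarrow> real \<Rightarrow> real mat set" where
  "EM n m \<alpha> = {S \<in> carrier_mat n m. full_rank S \<and>
     (\<forall>i<m. col S i \<bullet> col S i = 1) \<and>
     (\<forall>i<m. \<forall>j<m. i \<noteq> j \<longrightarrow> col S i \<bullet> col S j = \<alpha>)}"

end

theory Submission
  imports Defs
begin

text \<open>A Gram-Schmidt process towards equiangular instead of orthogonal vectors. Equiangular
  vectors \<open>s\<^sub>0, \<dots>, s\<^sub>k\<^sub>-\<^sub>1\<close> have Gram matrix \<open>(1 - \<alpha>) I + \<alpha> J\<close>, which has an explicit inverse as long
  as \<open>1 + (k - 1) \<alpha> > 0\<close>. This gives the component \<open>w \<noteq> 0\<close> of the next column of \<open>A\<close> orthogonal to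
  them. The next vector is \<open>\<beta> (s\<^sub>0 + \<dots> + s\<^sub>k\<^sub>-\<^sub>1) + \<gamma> w\<close> where \<open>\<beta> = \<alpha> / (1 + (k - 1) \<alpha>)\<close> produces the
  right inner products and \<open>\<gamma>\<close> the unit length; such a \<open>\<gamma> > 0\<close> exists because
  \<open>1 - k \<alpha>\<^sup>2 / (1 + (k - 1) \<alpha>) = (1 - \<alpha>) (1 + k \<alpha>) / (1 + (k - 1) \<alpha>) > 0\<close>.\<close>

section \<open>Inner products of real sequences on the first \<open>n\<close> coordinates\<close>

text \<open>Vectors are functions on the naturals of which only the first \<open>n\<close> values
  count; this keeps dimension side conditions out of the argument until the transfer to
  matrices.\<close>

definition dot :: "nat \<Rightarrow> (nat \<Rightarrow> real) \<Rightarrow> (nat \<Rightarrow> real) \<Rightarrow> real" where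
  "dot n u v = (\<Sum>l<n. u l * v l)"

lemma dot_commute: "dot n u v = dot n v u"
  by (simp add: dot_def mult.commute)

lemma dot_add_left: "dot n (\<lambda>l. u l + v l) w = dot n u w + dot n v w"
  by (simp add: dot_def algebra_simps sum.distrib)

lemma dot_diff_left: "dot n (\<lambda>l. u l - v l) w = dot n u w - dot n v w"
  by (simp add: dot_def algebra_simps sum_subtractf)

lemma dot_cmult_left: "dot n (\<lambda>l. c * u l) w = c * dot n u w"
  by (simp add: dot_def sum_distrib_left mult.assoc)

lemma dot_sum_left: "dot n (\<lambda>l. \<Sum>i\<in>I. u i l) w = (\<Sum>i\<in>I. dot n (u i) w)"
  unfolding dot_def sum_distrib_right by (rule sum.swap)

lemma dot_self_pos:
  assumes "l < n" and "u l \<noteq> 0"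
  shows "dot n u u > 0"
  unfolding dot_def
  by (rule sum_pos2[of _ l]) (use assms in \<open>auto simp: zero_less_mult_iff\<close>)

section \<open>Equiangular families and their extension by one vector\<close>

definition equiangular :: "nat \<Rightarrow> real \<Rightarrow> nat \<Rightarrow> (nat \<Rightarrow> nat \<Rightarrow> real) \<Rightarrow> bool" where
  "equiangular n \<alpha> k s \<longleftrightarrow> (\<forall>i<k. \<forall>j<k. dot n (s i) (s j) = (if i = j then 1 else \<alpha>))"

text \<open>Both sides are entry \<open>j\<close> of the Gram matrix (1 - \<alpha>) I + \<alpha> J
  applied to the coefficient vector \<open>x\<close>.\<close>

lemma dot_lincomb_equiangular:
  assumes "equiangular n \<alpha> k s" and "j < k"
  shows "dot n (\<lambda>l. \<Sum>i<k. x i * s i l) (s j) = (1 - \<alpha>) * x j + \<alpha> * (\<Sum>i<k. x i)"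
proof -
  have "dot n (\<lambda>l. \<Sum>i<k. x i * s i l) (s j) = (\<Sum>i<k. x i * (if i = j then 1 else \<alpha>))"
    unfolding dot_sum_left dot_cmult_left
    using assms by (intro sum.cong) (auto simp: equiangular_def)
  also have "\<dots> = (\<Sum>i<k. (if i = j then (1 - \<alpha>) * x i else 0) + \<alpha> * x i)"
    by (intro sum.cong) (auto simp: algebra_simps)
  finally show ?thesis
    using assms(2) by (simp add: sum.distrib sum_distrib_left)
qed

lemma equiangular_orthogonal_component:
  assumes s: "equiangular n \<alpha> k s" and "\<alpha> < 1" and D: "1 + (real k - 1) * \<alpha> > 0"
  obtains x where "\<And>j. j < k \<Longrightarrow> dot n (\<lambda>l. v l - (\<Sum>i<k. x i * s i l)) (s j) = 0"
proof -
  define D where "D = 1 + (real k - 1) * \<alpha>"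
  define b where "b j = dot n v (s j)" for j
  define \<sigma> where "\<sigma> = (\<Sum>j<k. b j)"
  \<comment> \<open>Solves the Gram system (1 - \<alpha>) x_j + \<alpha> (sum of x) = b_j: summing
    over j gives D (sum of x) = \<sigma>, which then determines each x_j.\<close>
  define x where "x j = (b j - \<alpha> * \<sigma> / D) / (1 - \<alpha>)" for j
  have D0: "D \<noteq> 0" and a0: "1 - \<alpha> \<noteq> 0" using assms by (auto simp: D_def)
  have "(\<Sum>j<k. x j) = (\<sigma> - real k * (\<alpha> * \<sigma> / D)) / (1 - \<alpha>)"
    by (simp add: x_def \<sigma>_def sum_subtractf flip: sum_divide_distrib)
  also have "\<dots> = \<sigma> / D"
  proof -
    have "\<sigma> - real k * (\<alpha> * \<sigma> / D) = \<sigma> / D * (D - real k * \<alpha>)"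
      using D0 by (simp add: field_simps)
    also have "D - real k * \<alpha> = 1 - \<alpha>" by (simp add: D_def algebra_simps)
    finally show ?thesis using a0 by simp
  qed
  finally have sx: "(\<Sum>j<k. x j) = \<sigma> / D" .
  have "dot n (\<lambda>l. v l - (\<Sum>i<k. x i * s i l)) (s j) = 0" if "j < k" for j
    unfolding dot_diff_left dot_lincomb_equiangular[OF s that] sx
    using a0 by (simp add: x_def b_def)
  then show ?thesis by (rule that)
qed

lemma equiangular_extend:
  assumes s: "equiangular n \<alpha> k s" and \<alpha>: "\<alpha> < 1"
    and D0: "1 + (real k - 1) * \<alpha> > 0" and E0: "1 + real k * \<alpha> > 0"
    and v: "\<And>x. \<exists>l<n. v l \<noteq> (\<Sum>i<k. x i * s i l)"
  obtains t x c where "equiangular n \<alpha> (Suc k) (s(k := t))" and "c \<noteq> 0"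
    and "\<And>l. t l = (\<Sum>i<k. x i * s i l) + c * v l"
proof -
  define D where "D = 1 + (real k - 1) * \<alpha>"
  obtain x where x: "\<And>j. j < k \<Longrightarrow> dot n (\<lambda>l. v l - (\<Sum>i<k. x i * s i l)) (s j) = 0"
    using equiangular_orthogonal_component[OF s \<alpha> D0, where v = v] by blast
  define w where "w l = v l - (\<Sum>i<k. x i * s i l)" for l
  define g where "g l = (\<Sum>i<k. s i l)" for l
  have ws: "dot n w (s j) = 0" if "j < k" for j
    using x[OF that] by (simp add: w_def[abs_def])
  \<comment> \<open>\<open>D\<close> is the common row sum of the Gram matrix, so the multiple
    \<alpha> / D of \<open>g\<close> has inner product \<alpha> with every
    \<open>s j\<close>.\<close>
  have gs: "dot n g (s j) = D" if "j < k" for j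
    using dot_lincomb_equiangular[OF s that, of "\<lambda>_. 1"]
    by (simp add: g_def[abs_def] D_def algebra_simps)
  have gw: "dot n g w = 0"
    unfolding g_def[abs_def] dot_sum_left by (rule sum.neutral) (simp add: dot_commute ws)
  have gg: "dot n g g = real k * D"
  proof -
    have "dot n (\<lambda>l. \<Sum>i<k. s i l) g = (\<Sum>i<k. D)"
      unfolding dot_sum_left by (rule sum.cong) (auto simp: gs dot_commute)
    then show ?thesis by (simp add: g_def[abs_def])
  qed
  obtain l where "l < n" "w l \<noteq> 0" using v[of x] by (auto simp: w_def)
  then have W: "dot n w w > 0" by (rule dot_self_pos)
  define \<beta> where "\<beta> = \<alpha> / D"
  \<comment> \<open>As \<open>g\<close> and \<open>w\<close> are orthogonal, the squared length of
    \<open>t\<close> is \<beta> \<beta> k D + \<gamma> \<gamma> (w . w); this \<gamma> makes it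
    1.\<close>
  define \<gamma> where "\<gamma> = sqrt ((1 - \<alpha>) * (1 + real k * \<alpha>) / D / dot n w w)"
  define t where "t l = \<beta> * g l + \<gamma> * w l" for l
  have D: "D > 0" using D0 by (simp add: D_def)
  have \<gamma>2: "\<gamma> * \<gamma> = (1 - \<alpha>) * (1 + real k * \<alpha>) / D / dot n w w"
    using \<alpha> E0 D W by (simp add: \<gamma>_def)
  have \<gamma>0: "\<gamma> \<noteq> 0" using \<alpha> E0 D W by (simp add: \<gamma>_def)
  have dot_t: "dot n t u = \<beta> * dot n g u + \<gamma> * dot n w u" for u
    by (simp add: t_def[abs_def] dot_add_left dot_cmult_left)
  have ts: "dot n t (s j) = \<alpha>" if "j < k" for j
    using that D by (simp add: dot_t gs ws \<beta>_def)
  have "dot n t t = \<beta> * dot n t g + \<gamma> * dot n t w"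
    using dot_t[of t] by (simp only: dot_commute[of n g t] dot_commute[of n w t])
  also have "\<dots> = \<beta> * \<beta> * (real k * D) + \<gamma> * \<gamma> * dot n w w"
    using gw gg by (simp add: dot_t dot_commute[of n w g])
  also have "\<dots> = (real k * \<alpha> * \<alpha> + (1 - \<alpha>) * (1 + real k * \<alpha>)) / D"
    using D W by (simp add: \<gamma>2 \<beta>_def field_simps)
  also have "real k * \<alpha> * \<alpha> + (1 - \<alpha>) * (1 + real k * \<alpha>) = D"
    by (simp add: D_def algebra_simps)
  finally have tt: "dot n t t = 1" using D by simp
  show ?thesis
  \<comment> \<open>The coefficient \<beta> - \<gamma> x_i of \<open>s i\<close> appears on
    expanding \<open>w\<close> in the definition of \<open>t\<close>.\<close>
  proof (rule that[of t \<gamma> "\<lambda>i. \<beta> - \<gamma> * x i"])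
    show "equiangular n \<alpha> (Suc k) (s(k := t))"
      using s ts tt by (auto simp: equiangular_def less_Suc_eq dot_commute[of n "s _" t])
    show "t l = (\<Sum>i<k. (\<beta> - \<gamma> * x i) * s i l) + \<gamma> * v l" for l
      by (simp add: t_def g_def w_def algebra_simps sum_distrib_left sum_subtractf)
  qed (fact \<gamma>0)
qed

section \<open>The inductive construction of the equiangular family\<close>

text \<open>Unrolling the recursion puts each \<open>s j\<close> into the span of the
  \<open>a i\<close>. All sums run to the same bound \<open>k\<close>, with zero padding, so that
  they can be added.\<close>

lemma triangular_lincomb:
  fixes a s :: "nat \<Rightarrow> nat \<Rightarrow> real"
  assumes "\<And>j. j < k \<Longrightarrow> \<exists>x c. \<forall>l. s j l = (\<Sum>i<j. x i * s i l) + c * a j l"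
    and "j < k"
  shows "\<exists>y. \<forall>l. s j l = (\<Sum>i<k. y i * a i l)"
  using assms(2)
proof (induction j rule: less_induct)
  case (less j)
  obtain x c where xc: "\<And>l. s j l = (\<Sum>i<j. x i * s i l) + c * a j l"
    using assms(1) less.prems by blast
  obtain y where y: "\<And>i l. i < j \<Longrightarrow> s i l = (\<Sum>h<k. y i h * a h l)"
    using less.IH less.prems by (metis less_trans)
  have *: "s j l = (\<Sum>h<k. ((\<Sum>i<j. x i * y i h) + (if h = j then c else 0)) * a h l)" for l
  proof -
    have "(\<Sum>i<j. x i * s i l) = (\<Sum>i<j. \<Sum>h<k. x i * y i h * a h l)"
      by (simp add: y sum_distrib_left mult.assoc)
    also have "\<dots> = (\<Sum>h<k. (\<Sum>i<j. x i * y i h) * a h l)"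
      unfolding sum_distrib_right by (rule sum.swap)
    moreover have "(\<Sum>h<k. (if h = j then c else 0) * a h l) = c * a j l"
      using less.prems by (simp add: if_distrib[of "\<lambda>z. z * _"] cong: if_cong)
    ultimately show ?thesis by (simp add: xc distrib_right sum.distrib)
  qed
  show ?case by (intro exI allI) (rule *)
qed

text \<open>Induction on \<open>k\<close>. The recorded relation with \<open>c\<close> nonzero can
  be solved for \<open>a j\<close>, which later yields column \<open>j\<close> of the triangular
  factor.\<close>

lemma equiangular_gram_schmidt:
  fixes a :: "nat \<Rightarrow> nat \<Rightarrow> real"
  assumes indep: "\<And>x. \<forall>l<n. (\<Sum>j<m. x j * a j l) = 0 \<Longrightarrow> \<forall>j<m. x j = 0"
    and "\<alpha> < 1" and pos: "\<And>k. k < m \<Longrightarrow> 1 + real k * \<alpha> > 0"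
    and "k \<le> m"
  shows "\<exists>s. equiangular n \<alpha> k s \<and>
    (\<forall>j<k. \<exists>x c. c \<noteq> 0 \<and> (\<forall>l. s j l = (\<Sum>i<j. x i * s i l) + c * a j l))"
  using \<open>k \<le> m\<close>
proof (induction k)
  case 0
  then show ?case by (simp add: equiangular_def)
next
  case (Suc k)
  then obtain s where s: "equiangular n \<alpha> k s"
    and sa: "\<And>j. j < k \<Longrightarrow> \<exists>x c. c \<noteq> 0 \<and> (\<forall>l. s j l = (\<Sum>i<j. x i * s i l) + c * a j l)"
    by auto
  have notspan: "\<exists>l<n. a k l \<noteq> (\<Sum>i<k. x i * s i l)" for x
  proof (rule ccontr)
    assume "\<not> ?thesis"
    then have ak: "a k l = (\<Sum>i<k. x i * s i l)" if "l < n" for l using that by blast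
    have "\<exists>y. \<forall>l. s j l = (\<Sum>i<k. y i * a i l)" if "j < k" for j
      using triangular_lincomb[OF _ that, of s a] sa by blast
    then obtain y where y: "\<And>i l. i < k \<Longrightarrow> s i l = (\<Sum>h<k. y i h * a h l)" by metis
    \<comment> \<open>If \<open>a k\<close> were in the span of the \<open>s i\<close>, it would be
      in the span of the earlier \<open>a h\<close>. These are the coefficients of the resulting
      relation, nontrivial because of the -1 and extended by zero to all \<open>m\<close>
      columns.\<close>
    define z where
      "z h = (if h < k then \<Sum>i<k. x i * y i h else if h = k then -1 else 0)" for h
    have "(\<Sum>h<m. z h * a h l) = 0" if "l < n" for l
    proof -
      have "(\<Sum>h<m. z h * a h l) = (\<Sum>h<Suc k. z h * a h l)"
        using Suc.prems by (intro sum.mono_neutral_right) (auto simp: z_def)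
      also have "\<dots> = (\<Sum>h<k. \<Sum>i<k. x i * y i h * a h l) - a k l"
        by (simp add: z_def sum_distrib_right)
      also have "(\<Sum>h<k. \<Sum>i<k. x i * y i h * a h l) = (\<Sum>i<k. \<Sum>h<k. x i * y i h * a h l)"
        by (rule sum.swap)
      also have "\<dots> = (\<Sum>i<k. x i * s i l)"
        by (simp add: y sum_distrib_left mult.assoc)
      finally show ?thesis using ak[OF that] by simp
    qed
    then have "\<forall>h<m. z h = 0" by (intro indep allI impI)
    then have "z k = 0" using Suc.prems by simp
    then show False by (simp add: z_def)
  qed
  \<comment> \<open>For \<open>k = 0\<close> the value is 1 - \<alpha>, so this case rests on
    \<alpha> < 1.\<close>
  have "1 + (real k - 1) * \<alpha> > 0"
    using pos[of "k - 1"] Suc.prems \<open>\<alpha> < 1\<close> by (cases k) simp_all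
  moreover have "1 + real k * \<alpha> > 0" using pos Suc.prems by simp
  ultimately obtain t x c where t: "equiangular n \<alpha> (Suc k) (s(k := t))" "c \<noteq> 0"
    "\<And>l. t l = (\<Sum>i<k. x i * s i l) + c * a k l"
    using equiangular_extend[OF s \<open>\<alpha> < 1\<close> _ _ notspan] by metis
  have "\<exists>x c. c \<noteq> 0 \<and> (\<forall>l. (s(k := t)) j l = (\<Sum>i<j. x i * (s(k := t)) i l) + c * a j l)"
    if "j < Suc k" for j
  proof (cases "j = k")
    case True
    then show ?thesis using t(2,3) by (intro exI[of _ x] exI[of _ c]) simp
  next
    case False
    then show ?thesis using sa[of j] that by simp
  qed
  with t(1) show ?case by blast
qed

text \<open>The Gram matrix is injective: pairing the relation with each \<open>s i\<close> and
  summing gives (1 + (k - 1) \<alpha>) \<sigma> = 0, hence \<sigma> = 0 and then each coefficient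
  vanishes.\<close>

lemma equiangular_indep:
  assumes s: "equiangular n \<alpha> k s" and \<alpha>: "\<alpha> < 1" and D: "1 + (real k - 1) * \<alpha> > 0"
    and x: "\<And>l. l < n \<Longrightarrow> (\<Sum>i<k. x i * s i l) = 0" and "j < k"
  shows "x j = 0"
proof -
  define \<sigma> where "\<sigma> = (\<Sum>i<k. x i)"
  have eq: "(1 - \<alpha>) * x i + \<alpha> * \<sigma> = 0" if "i < k" for i
    using dot_lincomb_equiangular[OF s that, of x] x by (simp add: dot_def \<sigma>_def)
  have "0 = (\<Sum>i<k. (1 - \<alpha>) * x i + \<alpha> * \<sigma>)" by (simp add: eq)
  also have "\<dots> = (1 - \<alpha>) * \<sigma> + real k * (\<alpha> * \<sigma>)"
    by (simp add: sum.distrib \<sigma>_def flip: sum_distrib_left)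
  also have "\<dots> = (1 + (real k - 1) * \<alpha>) * \<sigma>"
    by (simp add: algebra_simps)
  finally have "\<sigma> = 0" using D by simp
  then show ?thesis using eq[OF \<open>j < k\<close>] \<alpha> by simp
qed

section \<open>Full column rank as triviality of the kernel\<close>

lemma mult_unit_vec_eq_col:
  fixes A :: "'a::semiring_1 mat"
  assumes "A \<in> carrier_mat n m" and "j < m"
  shows "A *\<^sub>v unit_vec m j = col A j"
  using assms by (intro eq_vecI) auto

context vec_space
begin

text \<open>The rank is the size of a maximal independent subset of the set of columns, so a
  repeated column would make it too small. Distinctness lets independence of this set speak about
  the indexed columns.\<close>

lemma rank_eq_dim_col_imp_distinct_cols:
  assumes A: "A \<in> carrier_mat n nc" and r: "rank A = nc"
  shows "distinct (cols A)"
proof -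
  obtain S where S: "maximal S (\<lambda>T. T \<subseteq> set (cols A) \<and> lin_indpt T)"
    using maximal_exists_superset[of "set (cols A)" "\<lambda>T. T \<subseteq> set (cols A) \<and> lin_indpt T" "{}"]
    by (auto simp: finite_lin_indpt2)
  then have "card S \<le> card (set (cols A))"
    by (intro card_mono) (auto simp: maximal_def)
  then have "length (cols A) \<le> card (set (cols A))"
    using rank_card_indpt[OF A S] r A by simp
  then show ?thesis using card_length[of "cols A"] by (intro card_distinct) simp
qed

lemma rank_eq_dim_col_iff:
  assumes A: "A \<in> carrier_mat n nc"
  shows "rank A = nc \<longleftrightarrow> (\<forall>v\<in>carrier_vec nc. A *\<^sub>v v = 0\<^sub>v n \<longrightarrow> v = 0\<^sub>v nc)" (is "_ \<longleftrightarrow> ?R")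
proof
  assume r: "rank A = nc"
  have d: "distinct (cols A)" using rank_eq_dim_col_imp_distinct_cols[OF A r] .
  show ?R using lin_depI[OF A _ _ _ d] full_rank_lin_indpt[OF A r d] by blast
next
  assume R: ?R
  have d: "distinct (cols A)"
  proof (rule ccontr)
    assume "\<not> distinct (cols A)"
    then obtain i j where ij: "i < nc" "j < nc" "i \<noteq> j" "col A i = col A j"
      using A by (auto simp: distinct_conv_nth)
    \<comment> \<open>Two equal columns give a nonzero kernel vector.\<close>
    let ?v = "unit_vec nc i - unit_vec nc j :: 'a vec"
    have "A *\<^sub>v ?v = A *\<^sub>v unit_vec nc i - A *\<^sub>v unit_vec nc j"
      using A by (intro mult_minus_distrib_mat_vec) auto
    also have "\<dots> = 0\<^sub>v n"
      using ij A by (simp add: mult_unit_vec_eq_col[OF A])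
    finally have "A *\<^sub>v ?v = 0\<^sub>v n" .
    then have "?v = 0\<^sub>v nc" by (intro R[rule_format]) simp_all
    then have "?v $ i = 0\<^sub>v nc $ i" by (rule arg_cong)
    then show False using ij by simp
  qed
  show "rank A = nc"
  proof (rule lin_indpt_full_rank[OF A d], rule notI)
    assume "lin_dep (set (cols A))"
    then obtain v where "v \<in> carrier_vec nc" "v \<noteq> 0\<^sub>v nc" "A *\<^sub>v v = 0\<^sub>v n"
      by (rule lin_depE[OF A _ d])
    with R show False by simp
  qed
qed

end

text \<open>For \<open>m \<le> n\<close> full rank means rank \<open>m\<close>. Coefficients become
  functions, as in the construction above.\<close>

lemma full_rank_iff_trivial_kernel:
  fixes A :: "'a::field mat"
  assumes A: "A \<in> carrier_mat n m" and "m \<le> n"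
  shows "full_rank A \<longleftrightarrow>
    (\<forall>x. (\<forall>l<n. (\<Sum>j<m. x j * A $$ (l, j)) = 0) \<longrightarrow> (\<forall>j<m. x j = 0))"
proof -
  have entry: "(A *\<^sub>v v) $ l = (\<Sum>j<m. v $ j * A $$ (l, j))" if "l < n" "v \<in> carrier_vec m" for v l
    using A that by (simp add: scalar_prod_def atLeast0LessThan mult.commute)
  have ker: "A *\<^sub>v v = 0\<^sub>v n \<longleftrightarrow> (\<forall>l<n. (\<Sum>j<m. v $ j * A $$ (l, j)) = 0)"
    if "v \<in> carrier_vec m" for v
    using A that by (auto simp: entry[symmetric] vec_eq_iff)
  have "full_rank A \<longleftrightarrow> (\<forall>v\<in>carrier_vec m. A *\<^sub>v v = 0\<^sub>v n \<longrightarrow> v = 0\<^sub>v m)"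
    using vec_space.rank_eq_dim_col_iff[OF A] A \<open>m \<le> n\<close> by (simp add: full_rank_def min_absorb2)
  also have "\<dots> \<longleftrightarrow> (\<forall>x. (\<forall>l<n. (\<Sum>j<m. x j * A $$ (l, j)) = 0) \<longrightarrow> (\<forall>j<m. x j = 0))"
    (is "?L \<longleftrightarrow> ?R")
  proof
    assume L: ?L
    show ?R
    proof (intro allI impI)
      fix x j
      assume x: "\<forall>l<n. (\<Sum>j<m. x j * A $$ (l, j)) = 0" and j: "j < m"
      have "vec m x = 0\<^sub>v m" using L x ker[of "vec m x"] by simp
      then have "vec m x $ j = 0\<^sub>v m $ j" by (rule arg_cong)
      then show "x j = 0" using j by simp
    qed
  next
    assume R: ?R
    show ?L
    proof (intro ballI impI)
      fix v :: "'a vec"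
      assume v: "v \<in> carrier_vec m" "A *\<^sub>v v = 0\<^sub>v n"
      then have "\<forall>j<m. v $ j = 0" using R ker by blast
      then show "v = 0\<^sub>v m" using v(1) by auto
    qed
  qed
  finally show ?thesis .
qed

section \<open>Transfer to matrices and the factorisation\<close>

theorem theorem2p3:
  fixes n m :: nat and A :: "real mat" and \<alpha> :: real
  assumes "n \<ge> 2" and "m \<le> n"
    and "A \<in> carrier_mat n m" and "full_rank A"
    and "\<alpha> \<in> {- 1 / (real n - 1)<..<1}"
  shows "\<exists>S R. S \<in> EM n m \<alpha> \<and> R \<in> carrier_mat m m \<and> upper_triangular R \<and> A = S * R"
proof -
  define a where "a j l = A $$ (l, j)" for j l
  have \<alpha>: "\<alpha> < 1" using assms(5) by simp
  have pos: "1 + real k * \<alpha> > 0" if "k < n" for k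
  proof (cases "\<alpha> \<ge> 0")
    case False
    \<comment> \<open>For negative \<alpha> the worst case is k = n - 1, where the lower bound on
      \<alpha> applies.\<close>
    have "real k * \<alpha> \<ge> (real n - 1) * \<alpha>"
      using that False by (intro mult_right_mono_neg) auto
    moreover have "(real n - 1) * \<alpha> > -1"
      using assms(1,5) by (simp add: field_simps)
    ultimately show ?thesis by linarith
  qed (simp add: add_pos_nonneg)
  have indep: "\<forall>l<n. (\<Sum>j<m. x j * a j l) = 0 \<Longrightarrow> \<forall>j<m. x j = 0" for x
    using assms(2-4) full_rank_iff_trivial_kernel unfolding a_def by blast
  have pos_m: "1 + real k * \<alpha> > 0" if "k < m" for k
    using pos that assms(2) by simp
  have "\<exists>s. equiangular n \<alpha> m s \<and>
      (\<forall>j<m. \<exists>x c. c \<noteq> 0 \<and> (\<forall>l. s j l = (\<Sum>i<j. x i * s i l) + c * a j l))"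
    by (rule equiangular_gram_schmidt[where n = n and a = a, OF _ \<alpha> pos_m order_refl]) (erule indep)
  then obtain s where s: "equiangular n \<alpha> m s"
    and "\<forall>j<m. \<exists>x c. c \<noteq> 0 \<and> (\<forall>l. s j l = (\<Sum>i<j. x i * s i l) + c * a j l)"
    by blast
  then obtain x c where c: "\<And>j. j < m \<Longrightarrow> c j \<noteq> 0"
    and sa: "\<And>j l. j < m \<Longrightarrow> s j l = (\<Sum>i<j. x j i * s i l) + c j * a j l"
    by (auto simp: choice_iff')
  define S where "S = mat n m (\<lambda>(l, j). s j l)"
  \<comment> \<open>Column \<open>j\<close> holds the coefficients obtained by solving the relation
    \<open>sa\<close> for \<open>a j\<close>.\<close>
  define R where "R = mat m m (\<lambda>(i, j). if i < j then - x j i / c j else if i = j then 1 / c j else 0)"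
  have S: "S \<in> carrier_mat n m" and R: "R \<in> carrier_mat m m" by (auto simp: S_def R_def)
  have gram: "col S i \<bullet> col S j = dot n (s i) (s j)" if "i < m" "j < m" for i j
    using that by (simp add: S_def scalar_prod_def dot_def atLeast0LessThan)
  have D: "1 + (real m - 1) * \<alpha> > 0"
    using pos_m[of "m - 1"] \<alpha> by (cases m) simp_all
  have "full_rank S"
    unfolding full_rank_iff_trivial_kernel[OF S assms(2)]
  proof (intro allI impI)
    fix y j
    assume "\<forall>l<n. (\<Sum>j<m. y j * S $$ (l, j)) = 0" and j: "j < m"
    then have "(\<Sum>j<m. y j * s j l) = 0" if "l < n" for l
      using that by (simp add: S_def)
    then show "y j = 0" using equiangular_indep[OF s \<alpha> D _ j] by blast
  qed
  then have "S \<in> EM n m \<alpha>"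
    using S s by (simp add: EM_def gram equiangular_def)
  moreover have "upper_triangular R" by (auto simp: R_def)
  moreover have "A = S * R"
  proof (rule eq_matI)
    fix l j
    assume "l < dim_row (S * R)" and "j < dim_col (S * R)"
    then have l: "l < n" and j: "j < m" using S R by auto
    have "(S * R) $$ (l, j) =
        (\<Sum>i<m. s i l * (if i < j then - x j i / c j else if i = j then 1 / c j else 0))"
      using l j by (simp add: S_def R_def scalar_prod_def atLeast0LessThan)
    \<comment> \<open>The entries of \<open>R\<close> below the diagonal vanish; splitting off
      \<open>i = j\<close> then leaves the relation \<open>sa\<close>.\<close>
    also have "\<dots> = (\<Sum>i<Suc j. s i l * (if i < j then - x j i / c j else if i = j then 1 / c j else 0))"
      using j by (intro sum.mono_neutral_right) auto
    also have "\<dots> = (s j l - (\<Sum>i<j. x j i * s i l)) / c j"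
      by (simp add: sum_divide_distrib diff_divide_distrib sum_negf mult.commute)
    also have "\<dots> = A $$ (l, j)"
      using c[OF j] by (simp add: sa[OF j] a_def)
    finally show "A $$ (l, j) = (S * R) $$ (l, j)" by simp
  qed (use assms(3) S R in auto)
  ultimately show ?thesis using R by blast
qed

end
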